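(* Let $C_2$ be a cyclic group of order $2$. For every $n\ge 1$, the $C_2$-graded $n$-codimension $c_2(n)=c_n^{C_2}(M_2(\mathbb{C}))$ of $M_2(\mathbb{C})$ equipped with the $C_2$-crossed product grading is $$c_2(n)=\binom{2n+1}{n}-2^n+1.$$ In particular, as $n\to\infty$, $$c_2(n)\sim\frac{1}{\sqrt{\pi}}\,n^{-\frac12}\,2^{2n+1}.$$
   Context: Write $C_2=\{e,\sigma\}$. Crossed product grading (with $G=C_2$, $k=2$): index the rows and columns of $2\times2$ matrices by the elements of $C_2$, let $D_2$ be the set of diagonal matrices in $M_2(\mathbb{C})$, and for $g\in C_2$ let $P_g$ be the permutation matrix sending the standard basis vector indexed by $h$ to the one indexed by $gh$. The grading is $M_2(\mathbb{C})=D_2P_e\oplus D_2P_\sigma$; that is, the $e$-component consists of the diagonal matrices and the $\sigma$-component of the matrices with zero diagonal. Graded identities: let $\mathbb{Q}\langle X^{C_2}\rangle$ be the free associative algebra over $\mathbb{Q}$ on the noncommuting variables $x_{i,g}$, $i\ge1$, $g\in C_2$. A polynomial in it is a $C_2$-graded identity if it vanishes whenever each variable $x_{i,g}$ is replaced by an arbitrary element of $D_2P_g$. Let $\mathrm{Id}^{C_2}(M_2(\mathbb{C}))$ be the ideal of all such identities. Codimension: $P_n^{C_2}$ is the $\mathbb{Q}$-span of all monomials $x_{i_1,g_1}\cdots x_{i_n,g_n}$ with $\{i_1,\dots,i_n\}=\{1,\dots,n\}$ and $g_1,\dots,g_n\in C_2$ arbitrary, and $c_n^{C_2}(M_2(\mathbb{C}))=\dim_{\mathbb{Q}}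 P_n^{C_2}/(P_n^{C_2}\cap \mathrm{Id}^{C_2}(M_2(\mathbb{C})))$. The notation $a_n\sim b_n$ means $a_n/b_n\to1$. *)

theory Defs
  imports
    "Jordan_Normal_Form.Missing_VectorSpace"
    "HOL-Library.Poly_Mapping"
    "HOL-Library.Set_Algebras"
    "HOL-Library.Landau_Symbols"
    "HOL-Analysis.Analysis"
begin

section \<open>The free associative algebra\<close>

text \<open>
  Words get a type of their own because the ring structure on \<^typ>\<open>'w \<Rightarrow>\<^sub>0 rat\<close>
  is the convolution product for an additively written monoid \<^typ>\<open>'w\<close>.
\<close>

datatype 'v word = Word (letters: "'v list")

instantiation word :: (type) monoid_add
begin

definition "0 = Word []"
definition "u + v = Word (letters u @ letters v)"

instance
  by standard (simp_all add: zero_word_def plus_word_def)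

end

text \<open>
  Variables are pairs \<open>(i, g)\<close> with \<open>i\<close> counted from \<open>0\<close>:
  the variable \<open>x\<^bsub>i,g\<^esub>\<close> with \<open>i \<ge> 1\<close> is the pair \<open>(i - 1, g)\<close>.
\<close>

type_synonym 'g gvar = "nat \<times> 'g"

type_synonym 'g free_alg = "'g gvar word \<Rightarrow>\<^sub>0 rat"

definition var :: "'g gvar \<Rightarrow> 'g free_alg" where
  "var v = Poly_Mapping.single (Word [v]) 1"

definition scale :: "rat \<Rightarrow> 'g free_alg \<Rightarrow> 'g free_alg" where
  "scale c f = Poly_Mapping.single 0 c * f"

lemma prod_list_var: "prod_list (map var vs) = Poly_Mapping.single (Word vs) 1"
proof (induction vs)
  case Nil
  show ?case by (simp flip: zero_word_def)
next
  case (Cons v vs)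
  then show ?case by (simp add: var_def mult_single plus_word_def)
qed

global_interpretation free_alg: vector_space "scale :: rat \<Rightarrow> 'g free_alg \<Rightarrow> 'g free_alg"
  by standard
    (simp_all add: scale_def algebra_simps single_add mult_single flip: mult.assoc)


section \<open>The crossed product grading\<close>

text \<open>Groups of class \<^class>\<open>group_add\<close> are written additively, so \<open>g + h\<close> is the product \<open>gh\<close>.\<close>

type_synonym 'g group_mat = "complex^'g^'g"

definition diagonal_mats :: "'g::finite group_mat set" where
  "diagonal_mats = {D. \<forall>i j. i \<noteq> j \<longrightarrow> D $ i $ j = 0}"

definition group_perm_mat :: "'g::{finite,group_add} \<Rightarrow> 'g group_mat" where
  "group_perm_mat g = (\<chi> i j. if i = g + j then 1 else 0)"

definition crossed_component :: "'g::{finite,group_add} \<Rightarrow> 'g group_mat set" where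
  "crossed_component g = {D ** group_perm_mat g | D. D \<in> diagonal_mats}"

definition eval_word :: "('g::finite gvar \<Rightarrow> 'g group_mat) \<Rightarrow> 'g gvar word \<Rightarrow> 'g group_mat" where
  "eval_word \<phi> w = foldr (\<lambda>v A. \<phi> v ** A) (letters w) (mat 1)"

definition eval_alg :: "('g::finite gvar \<Rightarrow> 'g group_mat) \<Rightarrow> 'g free_alg \<Rightarrow> 'g group_mat" where
  "eval_alg \<phi> f = (\<Sum>w\<in>Poly_Mapping.keys f. of_rat (Poly_Mapping.lookup f w) *\<^sub>R eval_word \<phi> w)"

definition graded_identities :: "'g::{finite,group_add} free_alg set" where
  "graded_identities =
     {f. \<forall>\<phi>. (\<forall>i g. \<phi> (i, g) \<in> crossed_component g) \<longrightarrow> eval_alg \<phi> f = 0}"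


section \<open>Codimensions\<close>

definition multilinear_polys :: "nat \<Rightarrow> 'g free_alg set" where
  "multilinear_polys n =
     free_alg.span {prod_list (map var vs) | vs. length vs = n \<and> fst ` set vs = {..<n}}"

definition rat_ring :: "rat ring" where
  "rat_ring = \<lparr>carrier = UNIV, monoid.mult = (*), one = 1, zero = 0, add = (+)\<rparr>"

text \<open>
  The quotient \<open>V/W\<close> of a subspace \<open>V\<close> by a subspace \<open>W \<subseteq> V\<close> has as elements the cosets
  \<open>f +o W\<close>; the sum of cosets is the setwise sum. The summand \<open>W\<close> in the scalar multiple
  only matters for the scalar \<open>0\<close>. The fields \<open>mult\<close> and \<open>one\<close> are junk
  that the record type of modules carries along.
\<close>

definition quotient_space :: "'g free_alg set \<Rightarrow> 'g free_alg set \<Rightarrow> (rat, 'g free_alg set) module" where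
  "quotient_space V W =
     \<lparr>carrier = (\<lambda>f. f +o W) ` V, monoid.mult = undefined, one = undefined,
      zero = W, add = (+), module.smult = (\<lambda>c A. scale c ` A + W)\<rparr>"

definition graded_codim :: "'g::{finite,group_add} itself \<Rightarrow> nat \<Rightarrow> nat" where
  "graded_codim _ n =
     vectorspace.dim rat_ring
       (quotient_space (multilinear_polys n)
         (multilinear_polys n \<inter> (graded_identities :: 'g free_alg set)))"


section \<open>Evaluation is an algebra homomorphism\<close>

lemma eval_alg_superset:
  assumes "finite S" "Poly_Mapping.keys f \<subseteq> S"
  shows "eval_alg \<phi> f = (\<Sum>w\<in>S. of_rat (Poly_Mapping.lookup f w) *\<^sub>R eval_word \<phi> w)"
  unfolding eval_alg_def using assms
  by (intro sum.mono_neutral_left) (auto simp: in_keys_iff)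

lemma eval_alg_single: "eval_alg \<phi> (Poly_Mapping.single w c) = of_rat c *\<^sub>R eval_word \<phi> w"
  by (subst eval_alg_superset[of "{w}"]) auto

lemma eval_alg_add: "eval_alg \<phi> (f + g) = eval_alg \<phi> f + eval_alg \<phi> g"
proof -
  let ?S = "Poly_Mapping.keys f \<union> Poly_Mapping.keys g"
  have "Poly_Mapping.keys (f + g) \<subseteq> ?S"
    by (rule keys_add)
  then show ?thesis
    by (simp add: eval_alg_superset[of ?S] lookup_add of_rat_add scaleR_left_distrib sum.distrib)
qed

lemma eval_alg_0 [simp]: "eval_alg \<phi> 0 = 0"
  by (simp add: eval_alg_def)

lemma eval_word_append:
  "eval_word \<phi> (u + v) = eval_word \<phi> u ** eval_word \<phi> v"
proof -
  have "foldr (\<lambda>v A. \<phi> v ** A) xs B = foldr (\<lambda>v A. \<phi> v ** A) xs (mat 1) ** B" for xs B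
    by (induction xs) (simp_all add: matrix_mul_assoc)
  then show ?thesis
    unfolding eval_word_def plus_word_def word.sel foldr_append .
qed

lemma scaleR_matrix_mult:
  fixes A B :: "'g::finite group_mat"
  shows "(r *\<^sub>R A) ** B = r *\<^sub>R (A ** B)" "A ** (r *\<^sub>R B) = r *\<^sub>R (A ** B)"
  by (simp_all add: vec_eq_iff matrix_matrix_mult_def scaleR_sum_right)

lemma matrix_add_rdistrib':
  fixes A B C :: "'g::finite group_mat"
  shows "(A + B) ** C = A ** C + B ** C"
  by (simp add: vec_eq_iff matrix_matrix_mult_def algebra_simps sum.distrib)

lemma free_alg_induct [case_names zero add_single]:
  fixes f :: "'g free_alg"
  assumes "P 0" "\<And>f w c. P f \<Longrightarrow> P (f + Poly_Mapping.single w c)"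
  shows "P f"
proof (induction f rule: update_induct)
  case const
  show ?case by (rule assms(1))
next
  case (update f w c)
  have "Poly_Mapping.update w c f = f + Poly_Mapping.single w c"
    using update by (intro poly_mapping_eqI)
      (auto simp: lookup_update lookup_add lookup_single when_def in_keys_iff)
  then show ?case using assms(2) update by metis
qed

lemma eval_alg_mult: "eval_alg \<phi> (f * g) = eval_alg \<phi> f ** eval_alg \<phi> g"
proof (induction f rule: free_alg_induct)
  case zero
  show ?case by (simp add: matrix_matrix_mult_def zero_vec_def)
next
  case (add_single f u a)
  have "eval_alg \<phi> (Poly_Mapping.single u a * g) = eval_alg \<phi> (Poly_Mapping.single u a) ** eval_alg \<phi> g"
  proof (induction g rule: free_alg_induct)
    case zero
    show ?case by (simp add: matrix_matrix_mult_def zero_vec_def)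
  next
    case (add_single g v b)
    have "eval_alg \<phi> (Poly_Mapping.single u a * Poly_Mapping.single v b) =
        eval_alg \<phi> (Poly_Mapping.single u a) ** eval_alg \<phi> (Poly_Mapping.single v b)"
      by (simp add: mult_single eval_alg_single eval_word_append of_rat_mult scaleR_matrix_mult)
    with add_single show ?case
      by (simp add: distrib_left eval_alg_add matrix_add_ldistrib)
  qed
  with add_single show ?case
    by (simp add: distrib_right eval_alg_add matrix_add_rdistrib')
qed

lemma eval_alg_var: "eval_alg \<phi> (var v) = \<phi> v"
  by (simp add: var_def eval_alg_single eval_word_def)

lemma eval_alg_scale: "eval_alg \<phi> (scale c f) = of_rat c *\<^sub>R eval_alg \<phi> f"
  by (simp add: scale_def eval_alg_mult eval_alg_single eval_word_def zero_word_def
      scaleR_matrix_mult)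

lemma subspace_graded_identities: "free_alg.subspace graded_identities"
  by (auto simp: free_alg.subspace_def graded_identities_def eval_alg_add eval_alg_scale)


section \<open>The quotient is a vector space\<close>

lemma coset_add:
  assumes "free_alg.subspace W"
  shows "(f +o W) + (g +o W) = (f + g) +o W"
proof -
  have "W + W = W"
    using free_alg.subspace_add[OF assms] free_alg.subspace_0[OF assms]
    by (force simp: set_plus_def)
  then show ?thesis
    by (simp add: set_plus_rearrange)
qed

lemma coset_scale:
  assumes "free_alg.subspace W"
  shows "scale c ` (f +o W) + W = scale c f +o W"
proof
  show "scale c ` (f +o W) + W \<subseteq> scale c f +o W"
    using free_alg.subspace_add[OF assms] free_alg.subspace_scale[OF assms]
    by (fastforce simp: set_plus_def elt_set_plus_def free_alg.scale_right_distrib add.assoc)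
  show "scale c f +o W \<subseteq> scale c ` (f +o W) + W"
  proof
    fix x assume "x \<in> scale c f +o W"
    then obtain w where "w \<in> W" "x = scale c (f + 0) + w"
      by (auto simp: elt_set_plus_def)
    then show "x \<in> scale c ` (f +o W) + W"
      using free_alg.subspace_0[OF assms]
      by (blast intro: set_plus_intro set_plus_intro2)
  qed
qed

lemma field_rat_ring: "field rat_ring"
proof (rule cring.cring_fieldI2)
  show "cring rat_ring"
  proof (rule cringI)
    show "abelian_group rat_ring"
    proof (rule abelian_groupI)
      show "\<exists>y\<in>carrier rat_ring. y \<oplus>\<^bsub>rat_ring\<^esub> x = \<zero>\<^bsub>rat_ring\<^esub>" for x
        by (intro bexI[of _ "- x"]) (auto simp: rat_ring_def)
    qed (auto simp: rat_ring_def)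
    show "Group.comm_monoid rat_ring"
      by (rule comm_monoidI) (auto simp: rat_ring_def)
  qed (auto simp: rat_ring_def algebra_simps)
  show "\<zero>\<^bsub>rat_ring\<^esub> \<noteq> \<one>\<^bsub>rat_ring\<^esub>"
    by (simp add: rat_ring_def)
  show "\<exists>b\<in>carrier rat_ring. a \<otimes>\<^bsub>rat_ring\<^esub> b = \<one>\<^bsub>rat_ring\<^esub>"
    if "a \<noteq> \<zero>\<^bsub>rat_ring\<^esub>" for a
    using that by (intro bexI[of _ "inverse a"]) (auto simp: rat_ring_def)
qed

lemma vectorspace_quotient_space:
  assumes V: "free_alg.subspace V" and W: "free_alg.subspace W"
  shows "vectorspace rat_ring (quotient_space V W)"
proof -
  let ?Q = "quotient_space V W"
  have zero: "W = 0 +o W"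
    by simp
  have ab: "abelian_group ?Q"
  proof (rule abelian_groupI)
    show "\<exists>y\<in>carrier ?Q. y \<oplus>\<^bsub>?Q\<^esub> x = \<zero>\<^bsub>?Q\<^esub>" if x: "x \<in> carrier ?Q" for x
    proof -
      from x obtain f where f: "f \<in> V" "x = f +o W"
        by (auto simp: quotient_space_def)
      have "((- f) +o W) + (f +o W) = W"
        by (simp add: coset_add[OF W])
      moreover have "- f \<in> V"
        using f free_alg.subspace_neg[OF V] by blast
      ultimately show ?thesis
        using f by (auto simp: quotient_space_def)
    qed
    show "\<zero>\<^bsub>?Q\<^esub> \<in> carrier ?Q"
      using image_eqI[of W "\<lambda>f. f +o W", OF zero free_alg.subspace_0[OF V]] by (simp add: quotient_space_def)
    show "x \<oplus>\<^bsub>?Q\<^esub> y \<in> carrier ?Q" if "x \<in> carrier ?Q" "y \<in> carrier ?Q" for x y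
      using that free_alg.subspace_add[OF V] by (auto simp: quotient_space_def coset_add[OF W])
    show "\<zero>\<^bsub>?Q\<^esub> \<oplus>\<^bsub>?Q\<^esub> x = x" if "x \<in> carrier ?Q" for x
    proof -
      from that obtain f where "x = f +o W"
        by (auto simp: quotient_space_def)
      then show ?thesis
        using coset_add[OF W, of 0 f] by (simp add: quotient_space_def)
    qed
  qed (simp_all add: quotient_space_def ac_simps)
  have "Module.module rat_ring ?Q"
  proof (rule moduleI)
    show "cring rat_ring"
      using field_rat_ring by (simp add: field_def domain_def)
    show "abelian_group ?Q"
      by (rule ab)
  qed (use free_alg.subspace_scale[OF V] in
      \<open>auto simp: quotient_space_def rat_ring_def coset_add[OF W] coset_scale[OF W]
        coset_scale[OF W, of 1, simplified]
        simp flip: free_alg.scale_left_distrib free_alg.scale_right_distrib\<close>)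
  then show ?thesis
    using field_rat_ring by (simp add: vectorspace_def)
qed

lemma vectorspace_codim_quotient:
  "vectorspace rat_ring (quotient_space (multilinear_polys n) (multilinear_polys n \<inter> graded_identities))"
  by (intro vectorspace_quotient_space free_alg.subspace_inter subspace_graded_identities)
    (simp_all add: multilinear_polys_def free_alg.subspace_span)

end

theory Submission
  imports Defs "HOL-Real_Asymp.Real_Asymp"
begin

text \<open>
  A homogeneous matrix of degree \<open>g\<close> has exactly one possibly nonzero entry in row \<open>h\<close>, in column
  \<open>- g + h\<close>. Row \<open>h\<close> of the value of a word is therefore a commutative monomial in the entries of
  the substituted matrices: the word walks through the rows, and each letter contributes the
  entry in the row that the walk has reached. The order of the factors is lost, so two multilinear
  words are congruent modulo the graded identities as soon as they assign the same row to
  each letter (the set \<open>steps\<close>); different assignments are told apart by a substitution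
  with entries \<open>0\<close> and \<open>1\<close>. For any finite group, the codimension is hence the number of
  assignments that come from words (lemma \<open>graded_codim_eq_card_steps\<close>).

  For a group \<open>{0, s}\<close> an assignment is a directed multigraph on two vertices: letters of
  degree \<open>0\<close> are loops and letters of degree \<open>s\<close> cross from one vertex to the other. It
  comes from a word exactly if it has an Eulerian trail starting at \<open>0\<close>. This means that the number
  of crossings from \<open>0\<close> minus the number of crossings from \<open>s\<close> is \<open>0\<close> or \<open>1\<close>, and that
  all loops sit at \<open>0\<close> if there is no crossing (lemmas \<open>trail_exists\<close> and \<open>steps_image_eq\<close>).

  For the count, a letter with index \<open>i\<close> is encoded by a subset of \<open>{i} \<times> {0, s}\<close>: the full
  set for a crossing from \<open>0\<close>, the empty set for a crossing from \<open>s\<close>, a singleton for a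
  loop. The difference of the crossing numbers is then the size of the union minus \<open>n\<close>.
  The first condition leaves the subsets of a set with \<open>2 * n\<close> elements that have size \<open>n\<close>
  or \<open>n + 1\<close>, and their number is \<open>(2 * n choose n) + (2 * n choose (n + 1)) =
  (2 * n + 1) choose n\<close>. The second condition concerns the \<open>2 ^ n\<close> choices of loops only and
  keeps one of them (lemma \<open>card_steps_image\<close>).

  The asymptotic formula follows from that of the central binomial coefficients, which are up
  to sign and a power of \<open>4\<close> the generalised binomial coefficients of \<open>- 1/2\<close>.
\<close>

section \<open>Dimension of a quotient from dual functionals\<close>

text \<open>
  The functionals \<open>coord t\<close> identify \<open>V/W\<close> with the functions \<open>T \<rightarrow> \<rat>\<close>: they have common kernel
  \<open>W\<close> in \<open>V\<close>, and the dual vectors \<open>b t\<close> make the identification surjective. Hence the cosets of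
  the \<open>b t\<close> form a basis.
\<close>

lemma dim_quotient_space_dual:
  fixes coord :: "'t \<Rightarrow> 'g free_alg \<Rightarrow> rat" and b :: "'t \<Rightarrow> 'g free_alg"
  assumes V: "free_alg.subspace V" and W: "free_alg.subspace W" and T: "finite T"
    and add: "\<And>t f g. coord t (f + g) = coord t f + coord t g"
    and scale: "\<And>t c f. coord t (scale c f) = c * coord t f"
    and ker: "\<And>f. f \<in> W \<longleftrightarrow> f \<in> V \<and> (\<forall>t\<in>T. coord t f = 0)"
    and b: "\<And>t. t \<in> T \<Longrightarrow> b t \<in> V"
    and dual: "\<And>s t. s \<in> T \<Longrightarrow> t \<in> T \<Longrightarrow> coord t (b s) = (if s = t then 1 else 0)"
  shows "vectorspace.dim rat_ring (quotient_space V W) = card T"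
proof -
  let ?Q = "quotient_space V W"
  interpret Q: vectorspace rat_ring ?Q
    by (rule vectorspace_quotient_space[OF V W])
  define \<beta> where "\<beta> t = b t +o W" for t
  have diff: "coord t (f - g) = coord t f - coord t g" for t f g
    using add[of t "f - g" g] by simp
  have coset_eq: "f +o W = g +o W \<longleftrightarrow> (\<forall>t\<in>T. coord t f = coord t g)" if "f \<in> V" "g \<in> V" for f g
  proof -
    have "f +o W = g +o W \<longleftrightarrow> f - g \<in> W"
    proof
      assume eq: "f +o W = g +o W"
      have "f \<in> f +o W"
        using set_plus_intro2[OF free_alg.subspace_0[OF W], of f] by simp
      with eq show "f - g \<in> W"
        by (auto simp: elt_set_plus_def)
    next
      assume fg: "f - g \<in> W"
      have "(f - g) +o W = W"
        using free_alg.subspace_add[OF W fg] free_alg.subspace_diff[OF W _ fg]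
        by (force simp: elt_set_plus_def)
      then have "g +o ((f - g) +o W) = g +o W" by simp
      then show "f +o W = g +o W"
        by (simp add: set_plus_rearrange2)
    qed
    also have "\<dots> \<longleftrightarrow> (\<forall>t\<in>T. coord t f = coord t g)"
      using free_alg.subspace_diff[OF V that] by (simp add: ker diff)
    finally show ?thesis .
  qed
  have coord_sum: "coord t (\<Sum>s\<in>S. scale (a s) (b s)) = (if t \<in> S then a t else 0)"
    if "S \<subseteq> T" "t \<in> T" for S a t
  proof -
    have zero: "coord t 0 = 0"
      using add[of t 0 0] by simp
    have "finite S"
      using that T finite_subset by blast
    then show ?thesis
      using that(1) by (induction S) (use that(2) in \<open>auto simp: zero add scale dual\<close>)
  qed
  have sum_V: "(\<Sum>s\<in>S. scale (a s) (b s)) \<in> V" if "S \<subseteq> T" for S a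
    using that b by (intro free_alg.subspace_sum[OF V] free_alg.subspace_scale[OF V]) auto
  have inj: "inj_on \<beta> T"
  proof (rule inj_onI)
    fix s t assume "s \<in> T" "t \<in> T" "\<beta> s = \<beta> t"
    then have "coord s (b s) = coord s (b t)"
      by (simp add: \<beta>_def coset_eq b)
    with \<open>s \<in> T\<close> \<open>t \<in> T\<close> show "s = t"
      by (auto simp: dual split: if_splits)
  qed
  have carrier: "\<beta> ` T \<subseteq> carrier ?Q"
    using b by (auto simp: \<beta>_def quotient_space_def)
  have lincomb: "Q.lincomb a (\<beta> ` S) = (\<Sum>t\<in>S. scale (a (\<beta> t)) (b t)) +o W" if "S \<subseteq> T" for S a
  proof -
    have "finite S"
      using that T finite_subset by blast
    then show ?thesis
      using that
    proof (induction S)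
      case empty
      show ?case by (simp add: Q.lincomb_def) (simp add: quotient_space_def)
    next
      case (insert t S)
      have "Q.lincomb a (\<beta> ` S \<union> {\<beta> t}) =
          a (\<beta> t) \<odot>\<^bsub>?Q\<^esub> \<beta> t \<oplus>\<^bsub>?Q\<^esub> Q.lincomb a (\<beta> ` S)"
      proof (rule Q.lincomb_insert)
        show "\<beta> t \<notin> \<beta> ` S"
          using insert inj by (auto dest: inj_onD)
      qed (use insert carrier in \<open>auto simp: rat_ring_def\<close>)
      also have "a (\<beta> t) \<odot>\<^bsub>?Q\<^esub> \<beta> t = scale (a (\<beta> t)) (b t) +o W"
        by (simp add: quotient_space_def \<beta>_def coset_scale[OF W])
      finally show ?case
        using insert by (simp add: quotient_space_def coset_add[OF W])
    qed
  qed
  have "Q.basis (\<beta> ` T)"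
  proof (subst Q.basis_criterion)
    show "finite (\<beta> ` T)" using T by simp
    show "\<forall>v. v \<in> carrier ?Q \<longrightarrow>
        (\<exists>!a. a \<in> \<beta> ` T \<rightarrow>\<^sub>E carrier rat_ring \<and> Q.lincomb a (\<beta> ` T) = v)"
    proof (intro allI impI)
      fix v assume "v \<in> carrier ?Q"
      then obtain f where f: "f \<in> V" "v = f +o W"
        by (auto simp: quotient_space_def)
      have eq: "Q.lincomb a (\<beta> ` T) = v \<longleftrightarrow> (\<forall>t\<in>T. a (\<beta> t) = coord t f)" for a
        using f by (simp add: lincomb coset_eq sum_V coord_sum)
      define a where "a = restrict (\<lambda>x. coord (inv_into T \<beta> x) f) (\<beta> ` T)"
      show "\<exists>!a. a \<in> \<beta> ` T \<rightarrow>\<^sub>E carrier rat_ring \<and> Q.lincomb a (\<beta> ` T) = v"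
      proof (rule ex1I[of _ a])
        show "a \<in> \<beta> ` T \<rightarrow>\<^sub>E carrier rat_ring \<and> Q.lincomb a (\<beta> ` T) = v"
          unfolding eq by (auto simp: a_def inj rat_ring_def)
        show "a' = a" if "a' \<in> \<beta> ` T \<rightarrow>\<^sub>E carrier rat_ring \<and> Q.lincomb a' (\<beta> ` T) = v" for a'
          using that unfolding eq by (auto simp: a_def inj PiE_def extensional_def fun_eq_iff)
      qed
    qed
  qed (rule carrier)
  then have "Q.dim = card (\<beta> ` T)"
    using T by (intro Q.dim_basis) auto
  then show ?thesis
    by (simp add: card_image inj)
qed

section \<open>Words as walks through the rows\<close>

text \<open>
  Row \<open>i\<close> of a matrix of degree \<open>g\<close> has its only possibly nonzero entry in column \<open>- g + i\<close>.
  A product of homogeneous matrices can therefore be read off along a path through the rows.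
\<close>

lemma in_crossed_component_iff:
  fixes A :: "'g::{finite,group_add} group_mat"
  shows "A \<in> crossed_component g \<longleftrightarrow> (\<forall>i j. j \<noteq> - g + i \<longrightarrow> A $ i $ j = 0)"
proof -
  have eq: "i = g + j \<longleftrightarrow> j = - g + i" for i j :: 'g
    by (metis add.assoc add.left_inverse add.right_inverse add_0)
  have entry: "(D ** group_perm_mat g) $ i $ j = (if j = - g + i then D $ i $ i else 0)"
    if "D \<in> diagonal_mats" for D :: "'g group_mat" and i j
  proof -
    have "(D ** group_perm_mat g) $ i $ j = (\<Sum>k\<in>UNIV. D $ i $ k * (if k = g + j then 1 else 0))"
      by (simp add: matrix_matrix_mult_def group_perm_mat_def)
    also have "\<dots> = D $ i $ (g + j)"
      by (simp add: if_distrib cong: if_cong)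
    finally show ?thesis
      using that eq[of i j] by (auto simp: diagonal_mats_def)
  qed
  show ?thesis
  proof
    assume "A \<in> crossed_component g"
    then show "\<forall>i j. j \<noteq> - g + i \<longrightarrow> A $ i $ j = 0"
      by (auto simp: crossed_component_def entry)
  next
    assume A: "\<forall>i j. j \<noteq> - g + i \<longrightarrow> A $ i $ j = 0"
    define D :: "'g group_mat" where "D = (\<chi> i j. if i = j then A $ i $ (- g + i) else 0)"
    have D: "D \<in> diagonal_mats"
      by (simp add: D_def diagonal_mats_def)
    have "A = D ** group_perm_mat g"
      using A by (simp add: vec_eq_iff entry[OF D]) (simp add: D_def)
    with D show "A \<in> crossed_component g"
      by (auto simp: crossed_component_def)
  qed
qed

text \<open>
  The matrix entries that are multiplied when row \<open>h\<close> of a word is evaluated: \<open>(v, x)\<close> stands for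
  the entry of the matrix for \<open>v\<close> in row \<open>x\<close>. The order of the steps is forgotten, because
  the entries commute.
\<close>

fun steps :: "'g::group_add \<Rightarrow> 'g gvar list \<Rightarrow> ('g gvar \<times> 'g) set" where
  "steps h [] = {}"
| "steps h (v # vs) = insert (v, h) (steps (- snd v + h) vs)"

fun final_row :: "'g::group_add \<Rightarrow> 'g gvar list \<Rightarrow> 'g" where
  "final_row h [] = h"
| "final_row h (v # vs) = final_row (- snd v + h) vs"

lemma finite_steps [simp]: "finite (steps h vs)"
  by (induction h vs rule: steps.induct) auto

lemma fst_steps: "fst ` steps h vs = set vs"
  by (induction h vs rule: steps.induct) auto

lemma step_notin_steps: "v \<notin> set vs \<Longrightarrow> (v, h) \<notin> steps h' vs"
  using fst_steps[of h' vs] by force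

lemma card_steps: "distinct vs \<Longrightarrow> card (steps h vs) = length vs"
  by (induction h vs rule: steps.induct) (auto simp: step_notin_steps)

lemma inj_on_steps: "distinct (map fst vs) \<Longrightarrow> inj_on (fst \<circ> fst) (steps h vs)"
proof (induction h vs rule: steps.induct)
  case (2 h v vs)
  have "(fst \<circ> fst) ` steps (- snd v + h) vs = fst ` set vs"
    by (simp only: image_comp[symmetric] fst_steps)
  with 2 show ?case
    by (auto simp: inj_on_insert)
qed simp

text \<open>
  Right translation commutes with the left multiplications that move the path, so the steps from row
  \<open>0\<close> determine the steps from every other row. Agreement of two words in row \<open>0\<close> thus forces
  agreement everywhere.
\<close>

lemma steps_translate: "steps (h + k) vs = (\<lambda>(v, x). (v, x + k)) ` steps h vs"
  by (induction h vs rule: steps.induct) (simp_all add: add.assoc)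

lemma final_row_translate: "final_row (h + k) vs = final_row h vs + k"
  by (induction h vs rule: final_row.induct) (simp_all flip: add.assoc)

text \<open>
  Read a step \<open>((i, g), h)\<close> as an edge from \<open>h\<close> to \<open>- g + h\<close>, so that a word is a trail through the
  group. The outflow at \<open>x\<close> is then the out-degree minus the in-degree.
\<close>

definition outflow :: "('g::group_add gvar \<times> 'g) set \<Rightarrow> 'g \<Rightarrow> int" where
  "outflow t x = (\<Sum>(v, h)\<in>t. of_bool (h = x) - of_bool (- snd v + h = x))"

text \<open>
  Along a trail the differences telescope, and only its two end points survive.
\<close>

lemma outflow_steps:
  assumes "distinct vs"
  shows "outflow (steps h vs) x = of_bool (h = x) - of_bool (final_row h vs = x)"
  using assms
  by (induction h vs rule: steps.induct) (simp_all add: outflow_def step_notin_steps)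

text \<open>
  The end point of a trail can be recovered from its edges alone, by comparing outflows.
\<close>

lemma steps_determine_final_row:
  assumes "distinct vs" "distinct us" "steps h vs = steps h us"
  shows "final_row h vs = final_row h us"
  using outflow_steps[OF assms(1), of h "final_row h us"] outflow_steps[OF assms(2), of h "final_row h us"] assms(3)
  by (auto split: if_splits)

text \<open>
  A homogeneous matrix has at most one nonzero entry in each row, so every matrix product in the
  evaluation contributes a single summand.
\<close>

lemma eval_word_entry:
  assumes \<phi>: "\<And>i g. \<phi> (i, g) \<in> crossed_component g" and "distinct vs"
  shows "eval_word \<phi> (Word vs) $ h $ j =
    (if j = final_row h vs then \<Prod>(v, x)\<in>steps h vs. \<phi> v $ x $ (- snd v + x) else 0)"
  using \<open>distinct vs\<close>
proof (induction vs arbitrary: h)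
  case Nil
  show ?case by (simp add: eval_word_def mat_def)
next
  case (Cons v vs)
  have zero: "\<phi> v $ h $ k = 0" if "k \<noteq> - snd v + h" for k
    using \<phi>[of "fst v" "snd v"] that by (simp add: in_crossed_component_iff)
  have "eval_word \<phi> (Word (v # vs)) $ h $ j = (\<Sum>k\<in>UNIV. \<phi> v $ h $ k * eval_word \<phi> (Word vs) $ k $ j)"
    by (simp add: eval_word_def matrix_matrix_mult_def)
  also have "\<dots> = (\<Sum>k\<in>{- snd v + h}. \<phi> v $ h $ k * eval_word \<phi> (Word vs) $ k $ j)"
    by (rule sum.mono_neutral_right) (auto simp: zero)
  finally show ?case
    using Cons by (simp add: step_notin_steps)
qed

section \<open>The codimension as a number of step sets\<close>

definition multilinear_words :: "nat \<Rightarrow> 'g gvar list set" where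
  "multilinear_words n = {vs. length vs = n \<and> fst ` set vs = {..<n}}"

lemma distinct_multilinear_words:
  assumes "vs \<in> multilinear_words n"
  shows "distinct (map fst vs)" "distinct vs"
proof -
  show "distinct (map fst vs)"
    using assms by (intro card_distinct) (simp add: multilinear_words_def)
  then show "distinct vs"
    by (simp add: distinct_map)
qed

lemma finite_multilinear_words [simp]: "finite (multilinear_words n :: 'g::finite gvar list set)"
proof (rule finite_subset)
  show "multilinear_words n \<subseteq> {vs. set vs \<subseteq> {..<n} \<times> (UNIV :: 'g set) \<and> length vs = n}"
    unfolding multilinear_words_def by (auto simp del: image_eqI) (metis fst_conv image_eqI lessThan_iff)
  show "finite {vs. set vs \<subseteq> {..<n} \<times> (UNIV :: 'g set) \<and> length vs = n}"
    by (intro finite_lists_length_eq) simp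
qed

lemma monomial_in_multilinear_polys:
  "vs \<in> multilinear_words n \<Longrightarrow> Poly_Mapping.single (Word vs) 1 \<in> multilinear_polys n"
  unfolding multilinear_polys_def multilinear_words_def
  by (intro free_alg.span_base) (auto simp flip: prod_list_var)

lemma keys_multilinear_polys:
  assumes "f \<in> multilinear_polys n"
  shows "Poly_Mapping.keys f \<subseteq> Word ` multilinear_words n"
  using assms unfolding multilinear_polys_def
proof (induction rule: free_alg.span_induct_alt)
  case base
  show ?case by simp
next
  case (step c p f)
  then obtain vs where vs: "vs \<in> multilinear_words n" "p = prod_list (map var vs)"
    by (auto simp: multilinear_words_def)
  have "scale c p = Poly_Mapping.single (Word vs) c"
    by (simp add: vs prod_list_var scale_def mult_single)
  then have "Poly_Mapping.keys (scale c p) \<subseteq> {Word vs}"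
    by simp
  with step.IH vs(1) keys_add[of "scale c p" f] show ?case
    by blast
qed

lemma eval_multilinear_poly:
  fixes f :: "'g::finite free_alg"
  assumes "f \<in> multilinear_polys n"
  shows "eval_alg \<phi> f $ h $ j =
    (\<Sum>vs\<in>multilinear_words n. of_rat (Poly_Mapping.lookup f (Word vs)) *\<^sub>R eval_word \<phi> (Word vs) $ h $ j)"
proof -
  have "eval_alg \<phi> f =
      (\<Sum>w\<in>Word ` multilinear_words n. of_rat (Poly_Mapping.lookup f w) *\<^sub>R eval_word \<phi> w)"
    by (rule eval_alg_superset) (simp_all add: keys_multilinear_polys assms)
  also have "\<dots> =
      (\<Sum>vs\<in>multilinear_words n. of_rat (Poly_Mapping.lookup f (Word vs)) *\<^sub>R eval_word \<phi> (Word vs))"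
    by (subst sum.reindex) (simp_all add: inj_on_def)
  finally show ?thesis
    by (simp add: sum_component)
qed

text \<open>
  Multilinear words with the same steps have equal values under graded substitutions, so only the total
  coefficient of each such class of words matters.
\<close>

definition step_coeff :: "nat \<Rightarrow> ('g::group_add gvar \<times> 'g) set \<Rightarrow> 'g free_alg \<Rightarrow> rat" where
  "step_coeff n t f = (\<Sum>vs | vs \<in> multilinear_words n \<and> steps 0 vs = t. Poly_Mapping.lookup f (Word vs))"

text \<open>
  One substitution isolates the class of \<open>us\<close>: put \<open>1\<close> at the matrix entries that \<open>us\<close> uses and \<open>0\<close>
  elsewhere. A multilinear word survives in row \<open>0\<close> only if all its steps are steps of \<open>us\<close>; both
  have exactly \<open>n\<close> steps, so the step sets are then equal.
\<close>

lemma step_coeff_eq_zero_if_identity: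
  fixes f :: "'g::{finite,group_add} free_alg"
  assumes f: "f \<in> multilinear_polys n" "f \<in> graded_identities"
    and us: "us \<in> multilinear_words n"
  shows "step_coeff n (steps 0 us) f = 0"
proof -
  let ?t = "steps 0 us"
  define \<phi> :: "'g gvar \<Rightarrow> 'g group_mat" where
    "\<phi> v = (\<chi> x y. if y = - snd v + x \<and> (v, x) \<in> ?t then 1 else 0)" for v
  have \<phi>: "\<phi> (i, g) \<in> crossed_component g" for i g
    by (simp add: in_crossed_component_iff \<phi>_def)
  have word: "eval_word \<phi> (Word vs) $ 0 $ final_row 0 us = (if steps 0 vs = ?t then 1 else 0)"
    if vs: "vs \<in> multilinear_words n" for vs
  proof -
    have dist: "distinct vs" "distinct us"
      using vs us distinct_multilinear_words by blast+
    have "(\<Prod>(v, x)\<in>steps 0 vs. \<phi> v $ x $ (- snd v + x)) = (\<Prod>y\<in>steps 0 vs. if y \<in> ?t then 1 else 0)"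
      by (intro prod.cong) (auto simp: \<phi>_def)
    also have "\<dots> = (if steps 0 vs \<subseteq> ?t then 1 else 0)"
      by (cases "steps 0 vs \<subseteq> ?t") (auto intro!: prod.neutral)
    also have "steps 0 vs \<subseteq> ?t \<longleftrightarrow> steps 0 vs = ?t"
    proof
      assume "steps 0 vs \<subseteq> ?t"
      then show "steps 0 vs = ?t"
        using vs us by (intro card_subset_eq) (simp_all add: card_steps dist multilinear_words_def)
    qed simp
    finally show ?thesis
      using steps_determine_final_row[OF dist, of 0] by (auto simp: eval_word_entry[OF \<phi> dist(1)])
  qed
  have "0 = eval_alg \<phi> f $ 0 $ final_row 0 us"
    using f(2) \<phi> by (simp add: graded_identities_def)
  also have "\<dots> = (\<Sum>vs\<in>multilinear_words n. if steps 0 vs = ?t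
      then of_real (of_rat (Poly_Mapping.lookup f (Word vs))) else 0)"
    unfolding eval_multilinear_poly[OF f(1)]
    by (intro sum.cong refl) (simp add: word scaleR_conv_of_real)
  also have "\<dots> = (\<Sum>vs | vs \<in> multilinear_words n \<and> steps 0 vs = ?t.
      of_real (of_rat (Poly_Mapping.lookup f (Word vs))))"
    by (rule sum.inter_filter[symmetric]) simp
  also have "\<dots> = complex_of_real (of_rat (step_coeff n ?t f))"
    by (simp add: step_coeff_def of_rat_sum)
  finally show ?thesis
    by simp
qed

lemma identity_if_step_coeffs_eq_zero:
  fixes f :: "'g::{finite,group_add} free_alg"
  assumes f: "f \<in> multilinear_polys n"
    and zero: "\<And>us. us \<in> multilinear_words n \<Longrightarrow> step_coeff n (steps 0 us) f = 0"
  shows "f \<in> graded_identities"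
proof -
  have "eval_alg \<phi> f $ h $ j = 0" if \<phi>: "\<And>i g. \<phi> (i, g) \<in> crossed_component g" for \<phi> h j
  proof -
    let ?M = "multilinear_words n :: 'g gvar list set"
    let ?c = "\<lambda>vs. of_rat (Poly_Mapping.lookup f (Word vs)) :: real"
    let ?E = "\<lambda>vs. eval_word \<phi> (Word vs) $ h $ j"
    \<comment> \<open>The value is constant on classes, so the sum over a class is a multiple of its coefficient.\<close>
    have E_eq: "?E vs = ?E us" if "vs \<in> ?M" "us \<in> ?M" "steps 0 vs = steps 0 us" for vs us
    proof -
      have dist: "distinct vs" "distinct us"
        using that distinct_multilinear_words by blast+
      have "steps h vs = steps h us" "final_row h vs = final_row h us"
        using steps_translate[of 0 h vs] steps_translate[of 0 h us]
          final_row_translate[of 0 h vs] final_row_translate[of 0 h us]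
          steps_determine_final_row[OF dist that(3)] that(3) by simp_all
      then show ?thesis
        by (simp add: eval_word_entry[OF \<phi>] dist)
    qed
    have "(\<Sum>vs | vs \<in> ?M \<and> steps 0 vs = t. ?c vs *\<^sub>R ?E vs) = 0" if "t \<in> steps 0 ` ?M" for t
    proof -
      from that obtain us where us: "us \<in> ?M" "t = steps 0 us"
        by blast
      have "(\<Sum>vs | vs \<in> ?M \<and> steps 0 vs = t. ?c vs *\<^sub>R ?E vs) =
          (\<Sum>vs | vs \<in> ?M \<and> steps 0 vs = t. ?c vs *\<^sub>R ?E us)"
        using us by (intro sum.cong refl) (metis (mono_tags, lifting) E_eq mem_Collect_eq)
      also have "\<dots> = of_rat (step_coeff n t f) *\<^sub>R ?E us"
        by (simp add: step_coeff_def of_rat_sum scaleR_left.sum)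
      finally show ?thesis
        using zero us by simp
    qed
    then show ?thesis
      unfolding eval_multilinear_poly[OF f]
      by (subst sum.image_gen[of ?M _ "steps 0"]) simp_all
  qed
  then show ?thesis
    by (simp add: graded_identities_def vec_eq_iff)
qed

text \<open>
  For an arbitrary finite group the codimension counts the step sets of multilinear words, the
  class coefficients being coordinates on the quotient.
\<close>

lemma graded_codim_eq_card_steps:
  "graded_codim TYPE('g::{finite,group_add}) n =
    card (steps 0 ` (multilinear_words n :: 'g gvar list set))"
proof -
  let ?M = "multilinear_words n :: 'g gvar list set"
  define r where "r t = (SOME vs. vs \<in> ?M \<and> steps 0 vs = t)" for t
  have r: "r t \<in> ?M" "steps 0 (r t) = t" if "t \<in> steps 0 ` ?M" for t
  proof -
    have "\<exists>vs. vs \<in> ?M \<and> steps 0 vs = t"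
      using that by blast
    from someI_ex[OF this] show "r t \<in> ?M" "steps 0 (r t) = t"
      by (simp_all add: r_def)
  qed
  show ?thesis
    unfolding graded_codim_def
  proof (rule dim_quotient_space_dual[where coord = "step_coeff n" and b = "\<lambda>t. Poly_Mapping.single (Word (r t)) 1"])
    show V: "free_alg.subspace (multilinear_polys n :: 'g free_alg set)"
      by (simp add: multilinear_polys_def free_alg.subspace_span)
    show "free_alg.subspace (multilinear_polys n \<inter> graded_identities :: 'g free_alg set)"
      by (rule free_alg.subspace_inter[OF V subspace_graded_identities])
    show "step_coeff n t (f + g) = step_coeff n t f + step_coeff n t g" for t and f g :: "'g free_alg"
      by (simp add: step_coeff_def lookup_add sum.distrib)
    show "step_coeff n t (scale c f) = c * step_coeff n t f" for t c and f :: "'g free_alg"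
    proof -
      have "Poly_Mapping.lookup (scale c f) w = c * Poly_Mapping.lookup f w" for w
      proof (induction f rule: free_alg_induct)
        case zero
        show ?case by (simp add: scale_def)
      next
        case (add_single f u a)
        have "scale c (Poly_Mapping.single u a) = Poly_Mapping.single u (c * a)"
          by (simp add: scale_def mult_single)
        with add_single show ?case
          by (simp add: free_alg.scale_right_distrib lookup_add lookup_single when_def distrib_left)
      qed
      then show ?thesis
        by (simp add: step_coeff_def sum_distrib_left)
    qed
    show "f \<in> multilinear_polys n \<inter> graded_identities \<longleftrightarrow>
        f \<in> multilinear_polys n \<and> (\<forall>t\<in>steps 0 ` ?M. step_coeff n t f = 0)" for f
      using step_coeff_eq_zero_if_identity[of f n] identity_if_step_coeffs_eq_zero[of f n]
      by (simp add: Int_iff) blast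
    show "step_coeff n t (Poly_Mapping.single (Word (r s)) 1) = (if s = t then 1 else 0)"
      if "s \<in> steps 0 ` ?M" "t \<in> steps 0 ` ?M" for s t
    proof -
      have "step_coeff n t (Poly_Mapping.single (Word (r s)) 1) =
          (\<Sum>vs | vs \<in> ?M \<and> steps 0 vs = t. if vs = r s then 1 else 0)"
        unfolding step_coeff_def by (intro sum.cong refl) (auto simp: lookup_single when_def)
      also have "\<dots> = (if s = t then 1 else 0)"
        using r[OF that(1)] by (subst sum.delta) auto
      finally show ?thesis .
    qed
  qed (use r in \<open>auto intro: monomial_in_multilinear_polys\<close>)
qed

section \<open>Trails in a group of order two\<close>

lemma steps_constant_row:
  assumes "\<forall>v\<in>set vs. snd v = 0" "x \<in> steps h vs"
  shows "snd x = h"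
  using assms by (induction h vs rule: steps.induct) auto

text \<open>
  Graphs of functions that assign a degree and a row to every index below \<open>n\<close>.
\<close>

definition step_graphs :: "nat \<Rightarrow> ('g gvar \<times> 'g) set set" where
  "step_graphs n = {t. inj_on (fst \<circ> fst) t \<and> (fst \<circ> fst) ` t = {..<n}}"

lemma card_step_graphs:
  assumes "t \<in> step_graphs n"
  shows "finite t" "card t = n"
proof -
  have t: "inj_on (fst \<circ> fst) t" "(fst \<circ> fst) ` t = {..<n}"
    using assms by (auto simp: step_graphs_def)
  show "finite t"
    using finite_image_iff[OF t(1)] t(2) by simp
  show "card t = n"
    using card_image[OF t(1)] t(2) by simp
qed

lemma step_at_index_iff:
  assumes "t \<in> step_graphs n"
  shows "(\<exists>g p. ((i, g), p) \<in> t) \<longleftrightarrow> i < n"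
proof -
  have "(\<exists>g p. ((i, g), p) \<in> t) \<longleftrightarrow> i \<in> (fst \<circ> fst) ` t"
    by force
  also have "\<dots> \<longleftrightarrow> i < n"
    using assms unfolding step_graphs_def by blast
  finally show ?thesis .
qed

lemma steps_in_step_graphs:
  assumes "vs \<in> multilinear_words n"
  shows "steps h vs \<in> step_graphs n"
proof -
  have "(fst \<circ> fst) ` steps h vs = {..<n}"
    using assms by (simp only: image_comp[symmetric] fst_steps) (simp add: multilinear_words_def)
  then show ?thesis
    using inj_on_steps[OF distinct_multilinear_words(1)[OF assms]] by (simp add: step_graphs_def)
qed

context
  fixes s :: "'g::{finite,group_add}"
  assumes UNIV_s: "UNIV = {0, s}" and s_nonzero: "s \<noteq> 0"
begin

lemma group_cases: "x = 0 \<or> x = s" for x :: 'g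
  using UNIV_s by blast

lemma minus_s [simp]: "- s = s"
  using group_cases[of "- s"] s_nonzero by simp

lemma s_plus_s [simp]: "s + s = 0"
  by (metis minus_s right_minus)

lemma eq_s_plus_iff: "x = s + h \<longleftrightarrow> x \<noteq> h" for x h :: 'g
  using group_cases[of x] group_cases[of h] s_nonzero by auto

text \<open>
  This is Euler's theorem for directed trails on the two rows \<open>0\<close> and \<open>s\<close>; steps of degree \<open>0\<close> are
  loops and steps of degree \<open>s\<close> are edges between the rows. A greedy walk succeeds: use up all
  loops at the current row before crossing to the other one. A crossing replaces the outflow \<open>f\<close>
  at the current row by \<open>1 - f\<close>, so it stays in \<open>{0, 1}\<close>. The last assumption is
  connectedness: without an edge, no loop at the other row can be reached.
\<close>

lemma trail_exists:
  fixes t :: "('g gvar \<times> 'g) set"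
  assumes "finite t" and "inj_on (fst \<circ> fst) t" and "outflow t h \<in> {0, 1}"
    and "(\<exists>x\<in>t. snd (fst x) \<noteq> 0) \<or> (\<forall>x\<in>t. snd x = h)"
  shows "\<exists>vs. steps h vs = t \<and> distinct (map fst vs)"
  using assms
proof (induction "card t" arbitrary: t h)
  case 0
  then have "steps h [] = t"
    by simp
  then show ?case
    by (intro exI[of _ "[]"]) simp
next
  case (Suc k)
  have continue: ?case
    if x: "(v, h) \<in> t" and flow: "outflow (t - {(v, h)}) (- snd v + h) \<in> {0, 1}"
      and conn: "(\<exists>y\<in>t - {(v, h)}. snd (fst y) \<noteq> 0) \<or> (\<forall>y\<in>t - {(v, h)}. snd y = - snd v + h)"
    for v
  proof -
    let ?t' = "t - {(v, h)}"
    have "k = card ?t'"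
      using Suc.hyps(2) Suc.prems(1) x by simp
    moreover have "inj_on (fst \<circ> fst) ?t'"
      by (rule inj_on_subset[OF Suc.prems(2)]) blast
    ultimately obtain vs where vs: "steps (- snd v + h) vs = ?t'" "distinct (map fst vs)"
      using Suc.hyps(1)[of ?t' "- snd v + h"] Suc.prems(1) flow conn by auto
    have "fst v \<notin> fst ` set vs"
    proof
      assume "fst v \<in> fst ` set vs"
      then have "fst v \<in> (fst \<circ> fst) ` ?t'"
        by (simp only: image_comp[symmetric] vs(1)[symmetric] fst_steps)
      then obtain y where y: "y \<in> ?t'" "fst v = (fst \<circ> fst) y"
        by blast
      then show False
        using inj_onD[OF Suc.prems(2), of y "(v, h)"] x by simp
    qed
    then have "steps h (v # vs) = t \<and> distinct (map fst (v # vs))"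
      using vs x by auto
    then show ?thesis ..
  qed
  have remove: "outflow t y = of_bool (h = y) - of_bool (- snd v + h = y) + outflow (t - {(v, h)}) y"
    if "(v, h) \<in> t" for v y
    using that Suc.prems(1) by (simp add: outflow_def sum.remove[of t "(v, h)"])
  consider (stay) v where "(v, h) \<in> t" "snd v = 0" | (switch) v where "(v, h) \<in> t" "snd v = s"
      "\<And>y. y \<in> t \<Longrightarrow> snd (fst y) = 0 \<Longrightarrow> snd y \<noteq> h"
    | (stuck) "\<And>y. y \<in> t \<Longrightarrow> snd y \<noteq> h"
  proof (cases "\<exists>v. (v, h) \<in> t \<and> snd v = 0")
    case True
    then show thesis
      using stay by blast
  next
    case no_stay: False
    show thesis
    proof (cases "\<exists>v. (v, h) \<in> t")
      case True
      then obtain v where "(v, h) \<in> t" ..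
      moreover from this no_stay have "snd v = s"
        using group_cases by blast
      moreover have "snd y \<noteq> h" if "y \<in> t" "snd (fst y) = 0" for y
        using no_stay that by (cases y) auto
      ultimately show thesis
        by (rule switch)
    next
      case False
      then have "snd y \<noteq> h" if "y \<in> t" for y
        using that by (cases y) auto
      then show thesis
        by (rule stuck)
    qed
  qed
  then show ?case
  proof cases
    case stay
    have "outflow (t - {(v, h)}) (- snd v + h) \<in> {0, 1}"
      using Suc.prems(3) remove[OF stay(1), of h] stay(2) by simp
    moreover have "(\<exists>y\<in>t - {(v, h)}. snd (fst y) \<noteq> 0) \<or> (\<forall>y\<in>t - {(v, h)}. snd y = - snd v + h)"
      using Suc.prems(4) stay(2) by auto
    ultimately show ?thesis
      by (rule continue[OF stay(1)])
  next
    case switch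
    \<comment> \<open>An edge leaves one of the two rows and enters the other.\<close>
    have "outflow t' (s + h) = - outflow t' h" for t' :: "('g gvar \<times> 'g) set"
      unfolding outflow_def sum_negf[symmetric]
      by (intro sum.cong) (auto simp: eq_s_plus_iff)
    then have "outflow (t - {(v, h)}) (- snd v + h) \<in> {0, 1}"
      using Suc.prems(3) remove[OF switch(1), of h] eq_s_plus_iff[of h h] switch(2) by auto
    moreover have "(\<exists>y\<in>t - {(v, h)}. snd (fst y) \<noteq> 0) \<or> (\<forall>y\<in>t - {(v, h)}. snd y = - snd v + h)"
      using switch by (auto simp: eq_s_plus_iff)
    ultimately show ?thesis
      by (rule continue[OF switch(1)])
  next
    case stuck
    have "t \<noteq> {}"
      using Suc.hyps(2) by auto
    with Suc.prems(4) stuck obtain x where x: "x \<in> t" "snd (fst x) \<noteq> 0"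
      by fast
    \<comment> \<open>Only incoming edges remain at the current row, which makes its outflow negative.\<close>
    have "outflow t h < (\<Sum>x\<in>t. 0)"
      unfolding outflow_def
    proof (rule sum_strict_mono_ex1)
      show "\<exists>x\<in>t. (case x of (v, g) \<Rightarrow> of_bool (g = h) - of_bool (- snd v + g = h)) < (0 :: int)"
        using x stuck[OF x(1)] group_cases[of "snd (fst x)"] eq_s_plus_iff[of h "snd x"]
        by (intro bexI[of _ x]) (auto simp: case_prod_unfold)
    qed (use Suc.prems(1) stuck in auto)
    with Suc.prems(3) show ?thesis
      by simp
  qed
qed

text \<open>
  The two conditions are balance and connectedness of the multigraph, here for trails from \<open>0\<close>.
\<close>

lemma steps_image_eq:
  "steps 0 ` multilinear_words n = {t \<in> step_graphs n. outflow t 0 \<in> {0, 1} \<and>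
     ((\<forall>x\<in>t. snd (fst x) = 0) \<longrightarrow> (\<forall>x\<in>t. snd x = (0 :: 'g)))}" (is "?L = ?R")
proof
  show "?L \<subseteq> ?R"
  proof
    fix t assume "t \<in> ?L"
    then obtain vs where vs: "vs \<in> multilinear_words n" "t = steps 0 vs"
      by blast
    have "outflow t 0 \<in> {0, 1}"
      by (simp add: vs outflow_steps distinct_multilinear_words(2)[OF vs(1)])
    moreover have "\<forall>x\<in>t. snd x = 0" if "\<forall>x\<in>t. snd (fst x) = 0"
    proof -
      have "\<forall>v\<in>set vs. snd v = 0"
        using that vs(2) by (simp flip: fst_steps[of 0 vs])
      then show ?thesis
        using steps_constant_row vs(2) by blast
    qed
    ultimately show "t \<in> ?R"
      using steps_in_step_graphs[OF vs(1)] vs(2) by blast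
  qed
  show "?R \<subseteq> ?L"
  proof
    fix t assume t: "t \<in> ?R"
    then obtain vs where vs: "steps 0 vs = t" "distinct (map fst vs)"
      using trail_exists[of t 0] card_step_graphs(1)[of t n] by (auto simp: step_graphs_def)
    have fst_vs: "fst ` set vs = {..<n}"
    proof -
      have "fst ` set vs = (fst \<circ> fst) ` t"
        by (simp only: image_comp[symmetric] vs(1)[symmetric] fst_steps)
      then show ?thesis
        using t unfolding step_graphs_def by blast
    qed
    moreover have "length vs = n"
      using distinct_card[OF vs(2)] fst_vs by simp
    ultimately show "t \<in> ?L"
      using vs(1) by (auto simp: multilinear_words_def)
  qed
qed

section \<open>Counting the step sets\<close>

text \<open>
  The pair \<open>(g, p)\<close> has four values, as many as there are subsets of the group. This matching of
  pairs with subsets is chosen such that the number of elements exceeds \<open>1\<close> by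
  the contribution of a step \<open>((i, g), p)\<close> to the outflow at \<open>0\<close>. Step sets then correspond to
  subsets of \<open>{..<n} \<times> UNIV\<close> of prescribed size.
\<close>

definition fibre :: "'g \<Rightarrow> 'g \<Rightarrow> 'g set" where
  "fibre g p = (if g = 0 then {p} else if p = 0 then UNIV else {})"

definition encode :: "('g gvar \<times> 'g) set \<Rightarrow> (nat \<times> 'g) set" where
  "encode t = {(i, q). \<exists>g p. ((i, g), p) \<in> t \<and> q \<in> fibre g p}"

lemma UNIV_neq_singleton: "UNIV \<noteq> {p}" for p :: 'g
  using s_nonzero by (metis UNIV_I singletonD)

lemma fibre_eq_iff: "fibre g p = fibre g' p' \<longleftrightarrow> g = g' \<and> p = p'"
  using group_cases[of g] group_cases[of g'] group_cases[of p] group_cases[of p']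
    UNIV_neq_singleton UNIV_neq_singleton[symmetric] s_nonzero
  by (auto simp: fibre_def)

lemma fibre_exhaust: "\<exists>g p. fibre g p = B"
proof -
  have "B = {} \<or> B = UNIV \<or> B = {0} \<or> B = {s}"
    using subset_UNIV[of B] unfolding UNIV_s by blast
  moreover have "fibre s s = {}" "fibre s 0 = UNIV" "fibre 0 p = {p}" for p
    using s_nonzero by (simp_all add: fibre_def)
  ultimately show ?thesis
    by metis
qed

lemma card_fibre: "int (card (fibre g p)) = 1 + (of_bool (p = 0) - of_bool (- g + p = 0))"
  using group_cases[of g] group_cases[of p] s_nonzero by (auto simp: fibre_def UNIV_s)

lemma encode_row:
  assumes "t \<in> step_graphs n" "((i, g), p) \<in> t"
  shows "{q. (i, q) \<in> encode t} = fibre g p"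
  using assms by (fastforce simp: encode_def step_graphs_def inj_on_def)

lemma card_encode:
  assumes t: "t \<in> step_graphs n"
  shows "int (card (encode t)) = int n + outflow t 0"
proof -
  have "encode t = (\<Union>x\<in>t. {fst (fst x)} \<times> fibre (snd (fst x)) (snd x))"
    by (force simp: encode_def)
  also have "card \<dots> = (\<Sum>x\<in>t. card ({fst (fst x)} \<times> fibre (snd (fst x)) (snd x)))"
    using t card_step_graphs(1)[OF t]
    by (intro card_UN_disjoint) (auto simp: step_graphs_def inj_on_def)
  finally have "int (card (encode t)) = (\<Sum>x\<in>t. int (card (fibre (snd (fst x)) (snd x))))"
    by (simp add: card_cartesian_product)
  also have "\<dots> = int (card t) + outflow t 0"
    by (simp add: card_fibre sum.distrib outflow_def case_prod_unfold)
  finally show ?thesis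
    by (simp add: card_step_graphs(2)[OF t])
qed

lemma bij_betw_encode: "bij_betw encode (step_graphs n) (Pow ({..<n} \<times> UNIV))"
proof (rule bij_betw_imageI)
  have sub: "t \<subseteq> u" if t: "t \<in> step_graphs n" and u: "u \<in> step_graphs n" and eq: "encode t = encode u" for t u
  proof
    fix x assume x: "x \<in> t"
    obtain i g p where x_eq: "x = ((i, g), p)"
      by (metis surj_pair)
    obtain g' p' where y: "((i, g'), p') \<in> u"
      using x x_eq step_at_index_iff[OF t] step_at_index_iff[OF u] by blast
    have "fibre g p = fibre g' p'"
      using encode_row[OF t, of i g p] encode_row[OF u y] x x_eq eq by simp
    with y x_eq show "x \<in> u"
      by (simp add: fibre_eq_iff)
  qed
  then show "inj_on encode (step_graphs n)"
    by (intro inj_onI equalityI) simp_all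
  show "encode ` step_graphs n = Pow ({..<n} \<times> UNIV)"
  proof
    show "encode ` step_graphs n \<subseteq> Pow ({..<n} \<times> UNIV)"
      by (force simp: encode_def step_graphs_def)
    show "Pow ({..<n} \<times> UNIV) \<subseteq> encode ` step_graphs n"
    proof
      fix A :: "(nat \<times> 'g) set" assume A: "A \<in> Pow ({..<n} \<times> UNIV)"
      have "\<forall>i. \<exists>x. fibre (fst x) (snd x) = {q. (i, q) \<in> A}"
        using fibre_exhaust by (metis fst_conv snd_conv)
      from choice[OF this] obtain F where F: "\<And>i. fibre (fst (F i)) (snd (F i)) = {q. (i, q) \<in> A}"
        by blast
      let ?t = "(\<lambda>i. ((i, fst (F i)), snd (F i))) ` {..<n}"
      have "?t \<in> step_graphs n"
        by (simp add: step_graphs_def inj_on_def image_image)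
      moreover have "encode ?t = A"
      proof -
        have "encode ?t = {(i, q). i < n \<and> q \<in> fibre (fst (F i)) (snd (F i))}"
          by (auto simp: encode_def image_iff)
        then show ?thesis
          using A by (auto simp: F)
      qed
      ultimately show "A \<in> encode ` step_graphs n"
        by blast
    qed
  qed
qed

text \<open>
  The sets that meet each \<open>{i} \<times> UNIV\<close> exactly once. They encode the step graphs in which all
  degrees are \<open>0\<close>, of which only the one that stays in row \<open>0\<close> comes from a word.
\<close>

definition transversals :: "nat \<Rightarrow> (nat \<times> 'g) set set" where
  "transversals n = {A. A \<subseteq> {..<n} \<times> UNIV \<and> (\<forall>i<n. \<exists>!q. (i, q) \<in> A)}"

lemma fibre_singleton_iff: "(\<exists>!q. q \<in> fibre g p) \<longleftrightarrow> g = 0"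
proof
  assume "\<exists>!q. q \<in> fibre g p"
  then obtain q where "fibre g p = fibre 0 q"
    by (auto simp: fibre_def[of 0])
  then show "g = 0"
    by (simp add: fibre_eq_iff)
qed (simp add: fibre_def)

lemma encode_in_transversals_iff:
  assumes t: "t \<in> step_graphs n"
  shows "encode t \<in> transversals n \<longleftrightarrow> (\<forall>x\<in>t. snd (fst x) = 0)"
proof -
  have row: "(\<exists>!q. (fst (fst x), q) \<in> encode t) \<longleftrightarrow> snd (fst x) = 0" if "x \<in> t" for x
    using encode_row[OF t, of "fst (fst x)" "snd (fst x)" "snd x"] that
      fibre_singleton_iff[of "snd (fst x)" "snd x"] by auto
  have "encode t \<subseteq> {..<n} \<times> UNIV"
    using bij_betw_imp_surj_on[OF bij_betw_encode[of n]] t by blast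
  then have "encode t \<in> transversals n \<longleftrightarrow> (\<forall>i<n. \<exists>!q. (i, q) \<in> encode t)"
    by (simp add: transversals_def)
  also have "\<dots> \<longleftrightarrow> (\<forall>x\<in>t. \<exists>!q. (fst (fst x), q) \<in> encode t)"
    unfolding step_at_index_iff[OF t, symmetric] by force
  finally show ?thesis
    using row by simp
qed

lemma card_transversals: "card (transversals n) = 2 ^ n"
proof -
  let ?F = "{..<n} \<rightarrow>\<^sub>E (UNIV :: 'g set)"
  have "bij_betw (\<lambda>F. (\<lambda>i. (i, F i)) ` {..<n}) ?F (transversals n)"
  proof (rule bij_betw_imageI)
    show "inj_on (\<lambda>F. (\<lambda>i. (i, F i)) ` {..<n}) ?F"
    proof (rule inj_onI)
      fix F G assume F: "F \<in> ?F" "G \<in> ?F" and eq: "(\<lambda>i. (i, F i)) ` {..<n} = (\<lambda>i. (i, G i)) ` {..<n}"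
      show "F = G"
      proof (rule PiE_ext[OF F])
        fix i assume "i \<in> {..<n}"
        then have "(i, F i) \<in> (\<lambda>i. (i, G i)) ` {..<n}"
          using eq by blast
        then show "F i = G i"
          by auto
      qed
    qed
    show "(\<lambda>F. (\<lambda>i. (i, F i)) ` {..<n}) ` ?F = transversals n"
    proof
      show "(\<lambda>F. (\<lambda>i. (i, F i)) ` {..<n}) ` ?F \<subseteq> transversals n"
        by (auto simp: transversals_def)
      show "transversals n \<subseteq> (\<lambda>F. (\<lambda>i. (i, F i)) ` {..<n}) ` ?F"
      proof
        fix A assume A: "A \<in> transversals n"
        define F where "F = (\<lambda>i\<in>{..<n}. THE q. (i, q) \<in> A)"
        have F: "(i, F i) \<in> A" if "i < n" for i
          using A that theI'[of "\<lambda>q. (i, q) \<in> A"] by (simp add: transversals_def F_def)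
        have "i < n \<and> q = F i" if "(i, q) \<in> A" for i q
          using A that F[of i] by (auto simp: transversals_def)
        with F have "A = (\<lambda>i. (i, F i)) ` {..<n}"
          by force
        moreover have "F \<in> ?F"
          by (simp add: F_def)
        ultimately show "A \<in> (\<lambda>F. (\<lambda>i. (i, F i)) ` {..<n}) ` ?F"
          by blast
      qed
    qed
  qed
  then have "card (transversals n) = card ?F"
    by (simp add: bij_betw_same_card)
  also have "\<dots> = 2 ^ n"
    using s_nonzero by (simp add: card_PiE UNIV_s numeral_2_eq_2)
  finally show ?thesis .
qed

lemma card_transversal:
  assumes "A \<in> transversals n"
  shows "card A = n"
proof -
  have sub: "A \<subseteq> {..<n} \<times> UNIV" and ex1: "\<And>i. i < n \<Longrightarrow> \<exists>!q. (i, q) \<in> A"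
    using assms by (auto simp: transversals_def)
  have "bij_betw fst A {..<n}"
  proof (rule bij_betw_imageI)
    show "inj_on fst A"
    proof (rule inj_onI)
      fix x y assume "x \<in> A" "y \<in> A" "fst x = fst y"
      then show "x = y"
        using ex1[of "fst x"] sub by (cases x; cases y) auto
    qed
    show "fst ` A = {..<n}"
      using sub ex1 by force
  qed
  then show ?thesis
    by (simp add: bij_betw_same_card)
qed

text \<open>
  The encoding turns step sets of words into the subsets of \<open>{..<n} \<times> UNIV\<close> with \<open>n\<close> or \<open>n + 1\<close>
  elements, except that \<open>2 ^ n - 1\<close> of the \<open>2 ^ n\<close> transversals are missing.
\<close>

lemma card_steps_image:
  "int (card (steps (0 :: 'g) ` multilinear_words n)) = int ((2 * n + 1) choose n) - 2 ^ n + 1"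
proof -
  let ?X = "{..<n} \<times> (UNIV :: 'g set)"
  let ?Z = "{..<n} \<times> {0 :: 'g}"
  let ?S = "\<lambda>k. {A. A \<subseteq> ?X \<and> card A = k}"
  let ?R = "{A \<in> Pow ?X. (card A = n \<or> card A = n + 1) \<and>
    (A \<in> transversals n \<longrightarrow> (\<forall>x\<in>A. snd x = 0))}"
  let ?L = "{t \<in> step_graphs n. outflow t 0 \<in> {0, 1} \<and>
     ((\<forall>x\<in>t. snd (fst x) = 0) \<longrightarrow> (\<forall>x\<in>t. snd x = (0 :: 'g)))}"
  have X: "card ?X = 2 * n"
    using s_nonzero by (simp add: card_cartesian_product UNIV_s)
  have img: "encode ` ?L = ?R"
  proof -
    have "outflow t 0 \<in> {0, 1} \<and> ((\<forall>x\<in>t. snd (fst x) = 0) \<longrightarrow> (\<forall>x\<in>t. snd x = 0)) \<longleftrightarrow>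
        (card (encode t) = n \<or> card (encode t) = n + 1) \<and>
        (encode t \<in> transversals n \<longrightarrow> (\<forall>x\<in>encode t. snd x = 0))" if t: "t \<in> step_graphs n" for t
    proof -
      have "outflow t 0 \<in> {0, 1} \<longleftrightarrow> card (encode t) = n \<or> card (encode t) = n + 1"
        using card_encode[OF t] by auto
      moreover have "(\<forall>x\<in>encode t. snd x = 0) \<longleftrightarrow> (\<forall>x\<in>t. snd x = 0)" if zero: "\<forall>x\<in>t. snd (fst x) = 0"
      proof -
        have g: "g = 0" if "((i, g), p) \<in> t" for i g p
          using bspec[OF zero that] by simp
        have encode_iff: "(i, q) \<in> encode t \<longleftrightarrow> ((i, 0), q) \<in> t" for i q
        proof
          assume "(i, q) \<in> encode t"
          then obtain g' p where "((i, g'), p) \<in> t" "q \<in> fibre g' p"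
            by (auto simp: encode_def)
          with g[OF this(1)] show "((i, 0), q) \<in> t"
            by (simp add: fibre_def)
        next
          assume "((i, 0), q) \<in> t"
          moreover have "q \<in> fibre 0 q"
            by (simp add: fibre_def)
          ultimately show "(i, q) \<in> encode t"
            unfolding encode_def by blast
        qed
        show ?thesis
        proof
          assume enc: "\<forall>x\<in>encode t. snd x = 0"
          show "\<forall>x\<in>t. snd x = 0"
          proof
            fix x assume "x \<in> t"
            then have "((fst (fst x), 0), snd x) \<in> t"
              using zero by (metis prod.collapse)
            then show "snd x = 0"
              using enc encode_iff by fastforce
          qed
        next
          assume "\<forall>x\<in>t. snd x = 0"
          then show "\<forall>x\<in>encode t. snd x = 0"
            using encode_iff by fastforce
        qed
      qed
      ultimately show ?thesis
        using encode_in_transversals_iff[OF t] by blast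
    qed
    then show ?thesis
      unfolding bij_betw_imp_surj_on[OF bij_betw_encode[of n], symmetric] by blast
  qed
  have inj: "inj_on encode ?L"
    by (rule inj_on_subset[OF bij_betw_imp_inj_on[OF bij_betw_encode[of n]]]) blast
  have "card (steps (0 :: 'g) ` multilinear_words n) = card ?L"
    by (simp only: steps_image_eq)
  also have "\<dots> = card (encode ` ?L)"
    by (rule card_image[OF inj, symmetric])
  also note img
  also have "?R = ?S n \<union> ?S (n + 1) - (transversals n - {?Z})"
  proof -
    have "(\<forall>x\<in>A. snd x = 0) \<longleftrightarrow> A = ?Z" if "A \<in> transversals n" for A
      using that by (fastforce simp: transversals_def)
    then show ?thesis
      by blast
  qed
  also have "card \<dots> = card (?S n \<union> ?S (n + 1)) - card (transversals n - {?Z})"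
  proof (rule card_Diff_subset)
    show "transversals n - {?Z} \<subseteq> ?S n \<union> ?S (n + 1)"
      using card_transversal by (auto simp: transversals_def)
    show "finite (transversals n - {?Z})"
      by (rule finite_subset[of _ "Pow ?X"]) (auto simp: transversals_def)
  qed
  also have "card (transversals n - {?Z}) = 2 ^ n - 1"
  proof -
    have "?Z \<in> transversals n"
      by (auto simp: transversals_def)
    then show ?thesis
      by (simp add: card_transversals)
  qed
  also have "card (?S n \<union> ?S (n + 1)) = (2 * n + 1) choose n"
  proof -
    have "card (?S n \<union> ?S (n + 1)) = card (?S n) + card (?S (n + 1))"
      by (rule card_Un_disjoint) auto
    also have "\<dots> = ((2 * n) choose n) + ((2 * n) choose (n + 1))"
      by (simp add: n_subsets X del: Suc_eq_plus1)
    also have "\<dots> = (2 * n + 1) choose (n + 1)"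
      by simp
    also have "\<dots> = (2 * n + 1) choose n"
      by (subst binomial_symmetric) simp_all
    finally show ?thesis .
  qed
  finally have eq: "card (steps (0 :: 'g) ` multilinear_words n) = ((2 * n + 1) choose n) - (2 ^ n - 1)" .
  have "2 ^ n \<le> (2 * n + 1) choose n"
  proof -
    have "card (transversals n) \<le> card (?S n)"
      by (rule card_mono) (auto simp: card_transversal transversals_def)
    also have "\<dots> = (2 * n) choose n"
      by (simp add: n_subsets X)
    also have "\<dots> \<le> (2 * n + 1) choose n"
      by (simp add: binomial_right_mono)
    finally show ?thesis
      by (simp add: card_transversals)
  qed
  then show ?thesis
    unfolding eq by (simp add: of_nat_diff)
qed

end

section \<open>Asymptotics of the central binomial coefficients\<close>

text \<open>
  Expressing the central binomial coefficients as coefficients of \<open>(1 + x) powr (- 1/2)\<close> gives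
  access to the asymptotics of generalised binomial coefficients; the constant \<open>1 / sqrt pi\<close>
  arises as \<open>1 / Gamma (1/2)\<close>.
\<close>

lemma gchoose_minus_half:
  "((- (1 / 2) :: real) gchoose n) = (- 1) ^ n * real ((2 * n) choose n) / 4 ^ n"
proof (induction n)
  case (Suc n)
  have c: "real (Suc n) * real ((2 * Suc n) choose Suc n) = 2 * real (2 * n + 1) * real ((2 * n) choose n)"
  proof -
    have "Suc n * ((2 * Suc n) choose Suc n) = 2 * Suc n * (Suc (2 * n) choose n)"
      using Suc_times_binomial_eq[of "Suc (2*n)" n] by (simp add: mult_ac)
    then have "Suc n * ((2 * Suc n) choose Suc n) = Suc n * (2 * (Suc (2 * n) choose n))"
      by (simp only: mult_ac)
    then have "(2 * Suc n) choose Suc n = 2 * (Suc (2 * n) choose n)"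
      by (simp only: nat_mult_eq_cancel_disj) simp
    moreover have "Suc n * (Suc (2 * n) choose n) = Suc (2 * n) * ((2 * n) choose n)"
      using binomial_absorb_comp[of "Suc (2 * n)" n] by (simp add: mult_ac)
    ultimately have "Suc n * ((2 * Suc n) choose Suc n) = 2 * (Suc (2 * n) * ((2 * n) choose n))"
      by (metis mult.left_commute)
    then have "Suc n * ((2 * Suc n) choose Suc n) = 2 * (2 * n + 1) * ((2 * n) choose n)"
      by (simp only: mult.assoc Suc_eq_plus1)
    then show ?thesis
      by (metis of_nat_mult of_nat_numeral)
  qed
  have "real (Suc n) * ((- (1 / 2)) gchoose Suc n) = (- (1 / 2) - real n) * ((- (1 / 2)) gchoose n)"
    using gbinomial_mult_1[of "- (1 / 2) :: real" n] by (simp add: algebra_simps)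
  also have "\<dots> = - (2 * real (2 * n + 1)) / 4 * ((- 1) ^ n * real ((2 * n) choose n) / 4 ^ n)"
    unfolding Suc.IH by (simp add: field_simps)
  also have "\<dots> = real (Suc n) * ((- 1) ^ Suc n * real ((2 * Suc n) choose Suc n) / 4 ^ Suc n)"
  proof -
    have eq: "real (Suc n) * ((- 1) ^ Suc n * real ((2 * Suc n) choose Suc n) / 4 ^ Suc n) =
        (- 1) ^ Suc n / 4 ^ Suc n * (real (Suc n) * real ((2 * Suc n) choose Suc n))"
      by (simp only: times_divide_eq_left times_divide_eq_right mult_ac)
    show ?thesis
      unfolding eq c by (simp add: field_simps)
  qed
  finally show ?case
    by (simp only: mult_cancel_left) simp
qed simp

lemma central_binomial_asymp_equiv:
  "(\<lambda>n. real ((2 * n) choose n)) \<sim>[at_top] (\<lambda>n. 4 ^ n / sqrt (pi * real n))"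
proof -
  have "(\<lambda>n. (- (1 / 2) gchoose n) / ((- 1) ^ n / exp ((- (1 / 2) + 1) * ln (real n)))) \<longlonglongrightarrow>
      inverse (Gamma (- (- (1 / 2))) :: real)"
    using gbinomial_asymptotic[of "- (1 / 2) :: real"] by simp
  then have "(\<lambda>n. (- (1 / 2) gchoose n) / ((- 1) ^ n / exp ((- (1 / 2) + 1) * ln (real n))) * sqrt pi) \<longlonglongrightarrow>
      inverse (sqrt pi) * sqrt pi"
    by (intro tendsto_mult tendsto_const) (simp add: Gamma_one_half_real)
  moreover have "eventually (\<lambda>n. (- (1 / 2) gchoose n) / ((- 1) ^ n / exp ((- (1 / 2) + 1) * ln (real n))) * sqrt pi =
      real ((2 * n) choose n) / (4 ^ n / sqrt (pi * real n))) at_top"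
    using eventually_gt_at_top[of 0]
  proof eventually_elim
    case (elim n)
    have "exp (ln (real n) / 2) = sqrt (real n)"
      using elim by (simp flip: ln_sqrt)
    moreover have "x * B / y / (x / r) * p = B / (y / (p * r))" if "x \<noteq> 0" for x y B r p :: real
      using that by simp
    ultimately show ?case
      by (simp add: gchoose_minus_half real_sqrt_mult)
  qed
  ultimately have "(\<lambda>n. real ((2 * n) choose n) / (4 ^ n / sqrt (pi * real n))) \<longlonglongrightarrow>
      inverse (sqrt pi) * sqrt pi"
    using tendsto_cong by fast
  then show ?thesis
    by (intro asymp_equivI') simp
qed

lemma codimension_asymp_equiv:
  "(\<lambda>n. real ((2 * n + 1) choose n) - 2 ^ n + 1) \<sim>[at_top]
    (\<lambda>n. 1 / sqrt pi * real n powr (- (1 / 2)) * 2 ^ (2 * n + 1))"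
proof -
  have "real ((2 * n + 1) choose n) = (2 * real n + 1) / (real n + 1) * real ((2 * n) choose n)" for n
  proof -
    have "(n + 1) * ((2 * n + 1) choose n) = (2 * n + 1) * ((2 * n) choose n)"
      using binomial_absorb_comp[of "Suc (2 * n)" n] by (simp add: mult_ac)
    then have "real (n + 1) * real ((2 * n + 1) choose n) = real (2 * n + 1) * real ((2 * n) choose n)"
      by (metis of_nat_mult)
    then show ?thesis
      by (simp add: field_simps)
  qed
  moreover have "(\<lambda>n. (2 * real n + 1) / (real n + 1) * real ((2 * n) choose n)) \<sim>[at_top]
      (\<lambda>n. (2 * real n + 1) / (real n + 1) * (4 ^ n / sqrt (pi * real n)))"
    by (intro asymp_equiv_intros central_binomial_asymp_equiv)
  moreover have "(\<lambda>n. (2 * real n + 1) / (real n + 1) * (4 ^ n / sqrt (pi * real n))) \<sim>[at_top]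
      (\<lambda>n. 2 * (4 ^ n / sqrt (pi * real n)))"
    by (intro asymp_equiv_intros) real_asymp
  moreover have "(\<lambda>n. 2 * (4 ^ n / sqrt (pi * real n))) =
      (\<lambda>n. 1 / sqrt pi * real n powr (- (1 / 2)) * 2 ^ (2 * n + 1))"
  proof -
    have pow: "(2 :: real) ^ (2 * n + 1) = 2 * 4 ^ n" for n
      by (simp add: power_mult)
    then show ?thesis
      unfolding pow by (simp add: fun_eq_iff real_sqrt_mult powr_minus powr_half_sqrt field_simps)
  qed
  ultimately have main: "(\<lambda>n. real ((2 * n + 1) choose n)) \<sim>[at_top]
      (\<lambda>n. 1 / sqrt pi * real n powr (- (1 / 2)) * 2 ^ (2 * n + 1))"
    using asymp_equiv_trans by simp
  have "(\<lambda>n. 1 - 2 ^ n) \<in> o(\<lambda>n. 1 / sqrt pi * real n powr (- (1 / 2)) * 2 ^ (2 * n + 1))"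
  proof -
    have "(\<lambda>n. 1 - 2 ^ n) \<in> o(\<lambda>n. real n powr (- (1 / 2)) * (2 * 4 ^ n))"
      by real_asymp
    then show ?thesis
      by (simp add: power_mult mult.assoc)
  qed
  then have "(\<lambda>n. 1 - 2 ^ n) \<in> o(\<lambda>n. real ((2 * n + 1) choose n))"
    by (subst landau_o.small.cong_bigtheta[OF asymp_equiv_imp_bigtheta[OF main]])
  then have "(\<lambda>n. real ((2 * n + 1) choose n) + (1 - 2 ^ n)) \<sim>[at_top] (\<lambda>n. real ((2 * n + 1) choose n))"
    by (simp add: asymp_equiv_add_right)
  with main show ?thesis
    using asymp_equiv_trans by (simp add: algebra_simps)
qed

section \<open>The codimension sequence\<close>

theorem theorem18:
  assumes "CARD('g::{finite,group_add}) = 2"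
  shows "(\<forall>n\<ge>1. int (graded_codim TYPE('g) n) = int ((2 * n + 1) choose n) - 2 ^ n + 1) \<and>
    (\<lambda>n. real (graded_codim TYPE('g) n)) \<sim>[at_top]
      (\<lambda>n. 1 / sqrt pi * real n powr (- (1 / 2)) * 2 ^ (2 * n + 1))"
proof -
  obtain s :: 'g where s: "UNIV = {0, s}" "s \<noteq> 0"
  proof -
    obtain x y :: 'g where "UNIV = {x, y}" "x \<noteq> y"
      using assms by (auto simp: card_2_iff)
    moreover from this have "0 = x \<or> 0 = y"
      by blast
    ultimately show thesis
      using that[of x] that[of y] by (auto simp: insert_commute)
  qed
  have codim: "int (graded_codim TYPE('g) n) = int ((2 * n + 1) choose n) - 2 ^ n + 1" for n
    unfolding graded_codim_eq_card_steps by (rule card_steps_image[OF s])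
  have "real (graded_codim TYPE('g) n) = real ((2 * n + 1) choose n) - 2 ^ n + 1" for n
    using arg_cong[OF codim[of n], of real_of_int] by simp
  then show ?thesis
    using codim codimension_asymp_equiv by simp
qed

end
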